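(* Let $a>0$, $T>0$ and let $f:\mathbb{R}\to\mathbb{R}$ be a continuous $T$-periodic function with $\int_0^T f(t)\,dt=0$. Consider the system $$\dot q=\frac{p}{\sqrt{p^2+1}},\qquad \dot p=-a\sin q+f(t).$$ If $a<\frac{\pi^2}{T^2}$, then the Poincaré map associated to this system satisfies the twist condition. If $a=\frac{\pi^2}{T^2}$ and $f$ does not vanish identically, the same result holds true. Moreover, the condition $a\le\frac{\pi^2}{T^2}$ is optimal, in the sense that for every $a>\frac{\pi^2}{T^2}$ there is a continuous $T$-periodic $f$ with mean value zero for which the Poincaré map does not satisfy the twist condition.
   Context: The system is the Hamiltonian system $\dot q=H_p$, $\dot p=-H_q$ with $H=\sqrt{p^2+1}-a\cos q-f(t)q$. Its Poincaré map is $S(q_0,p_0)=(Q(q_0,p_0),P(q_0,p_0))=(q(T,q_0,p_0),p(T,q_0,p_0))$, where $(q(t,q_0,p_0),p(t,q_0,p_0))$ is the (globally defined) solution with initial condition $(q_0,p_0)$ at $t=0$. The map $S$ satisfies the twist condition (is twist) if $\frac{\partial Q}{\partial p_0}(q_0,p_0)>0$ for all $(q_0,p_0)\in\mathbb{R}^2$. *)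

theory Defs
  imports "HOL-Analysis.Analysis"
begin

definition pendulum_solution ::
  "real \<Rightarrow> (real \<Rightarrow> real) \<Rightarrow> (real \<Rightarrow> real) \<Rightarrow> (real \<Rightarrow> real) \<Rightarrow> bool" where
  "pendulum_solution a f q p \<longleftrightarrow>
     (\<forall>t. (q has_real_derivative p t / sqrt ((p t)\<^sup>2 + 1)) (at t) \<and>
          (p has_real_derivative - a * sin (q t) + f t) (at t))"

text \<open>For continuous \<open>f\<close> every initial value problem has exactly one solution on the whole
  real line (the vector field is continuous in time and globally Lipschitz in the state), so the
  definite description below denotes that solution.\<close>

definition trajectory ::
  "real \<Rightarrow> (real \<Rightarrow> real) \<Rightarrow> real \<times> real \<Rightarrow> real \<Rightarrow> real \<times> real" where
  "trajectory a f z0 =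
     (THE z. pendulum_solution a f (\<lambda>t. fst (z t)) (\<lambda>t. snd (z t)) \<and> z 0 = z0)"

definition poincare_map ::
  "real \<Rightarrow> (real \<Rightarrow> real) \<Rightarrow> real \<Rightarrow> real \<times> real \<Rightarrow> real \<times> real" where
  "poincare_map a f T z0 = trajectory a f z0 T"

text \<open>The existential asserts that the partial derivative of the first component with respect to
  the second variable exists; \<open>deriv\<close> alone would be unspecified at points where it does not.\<close>

definition twist :: "(real \<times> real \<Rightarrow> real \<times> real) \<Rightarrow> bool" where
  "twist S \<longleftrightarrow>
     (\<forall>q0 p0. \<exists>D > 0. ((\<lambda>p. fst (S (q0, p))) has_real_derivative D) (at p0))"

definition admissible_forcing :: "real \<Rightarrow> (real \<Rightarrow> real) \<Rightarrow> bool" where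
  "admissible_forcing T f \<longleftrightarrow>
     continuous_on UNIV f \<and> (\<forall>t. f (t + T) = f t) \<and> integral {0..T} f = 0"

end

theory Submission
  imports Defs "HOL-Library.Periodic_Fun"
begin

text \<open>The derivative of the final position with respect to the initial momentum solves the linearised
  equations \<open>\<xi>' = w * \<eta>\<close>, \<open>\<eta>' = - c * \<xi>\<close> with \<open>\<xi> 0 = 0\<close>, \<open>\<eta> 0 = 1\<close>, where
  \<open>w = (p\<^sup>2 + 1) powr (- 3 / 2)\<close> and \<open>c = a * cos q\<close> are taken along the orbit. Relativity only slows the
  oscillation down (\<open>w \<le> 1\<close>), and \<open>c \<le> a\<close>, so \<open>\<xi>\<close> cannot return to zero before the harmonic
  oscillator \<open>\<xi>'' = - a * \<xi>\<close> does, at \<open>pi / sqrt a \<ge> T\<close>. It can do so at time \<open>T\<close> only if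
  \<open>a = (pi / T)\<^sup>2\<close>, \<open>p = 0\<close> and \<open>cos q = 1\<close> throughout, that is, if the unforced pendulum hangs at
  rest. This comparison is \<open>sturm_positive\<close>; its consequences for the Poincare map are
  \<open>twist_subcritical\<close> and \<open>twist_critical\<close>.

  The bound is sharp because of the free pendulum, \<open>f = 0\<close>. If \<open>a > (pi / T)\<^sup>2\<close>, small oscillations
  have half-period below \<open>T\<close>, and the half-period grows without bound as the amplitude increases
  to that of the upright equilibrium. Some oscillation therefore has half-period exactly \<open>T\<close>
  (\<open>half_period_orbit_exists\<close>); it starts and ends at position \<open>0\<close>, like the pendulum at rest, so
  the final position is not strictly monotone in the initial momentum (\<open>not_twist_supercritical\<close>).

  To speak about the flow at all, the first parts prove what is required of the theory of globally
  Lipschitz differential equations: uniqueness (\<open>solves_ode_unique\<close>), existence for all times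
  (\<open>ode_global_existence\<close>) and differentiability in the initial value
  (\<open>flow_has_vector_derivative\<close>).\<close>

section \<open>Growth estimates and uniqueness\<close>

lemma gronwall_linear:
  fixes E :: "real \<Rightarrow> real"
  assumes "a \<le> b" and "K \<ge> 0" and "\<rho> \<ge> 0"
    and deriv: "\<And>t. (E has_real_derivative E' t) (at t)"
    and bound: "\<And>t. a \<le> t \<Longrightarrow> t \<le> b \<Longrightarrow> E' t \<le> K * E t + \<rho>"
  shows "E b \<le> exp (K * (b - a)) * (E a + \<rho> * (b - a))"
proof -
  define G where "G t = E t * exp (- K * (t - a)) - \<rho> * (t - a)" for t
  have G': "(G has_real_derivative (E' t - K * E t) * exp (- K * (t - a)) - \<rho>) (at t)" for t
    unfolding G_def by (auto intro!: derivative_eq_intros deriv simp: algebra_simps)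
  have "(E' t - K * E t) * exp (- K * (t - a)) - \<rho> \<le> 0" if "a \<le> t" "t \<le> b" for t
  proof -
    have "(E' t - K * E t) * exp (- K * (t - a)) \<le> \<rho> * exp (- K * (t - a))"
      using bound[OF that] by (intro mult_right_mono) auto
    also have "\<dots> \<le> \<rho> * 1"
      using that \<open>K \<ge> 0\<close> \<open>\<rho> \<ge> 0\<close> by (intro mult_left_mono) auto
    finally show ?thesis by simp
  qed
  then have "G b \<le> G a"
    using G' by (intro DERIV_nonpos_imp_nonincreasing[OF \<open>a \<le> b\<close>]) blast
  then have "E b * exp (- K * (b - a)) \<le> E a + \<rho> * (b - a)"
    by (simp add: G_def)
  then have "exp (K * (b - a)) * (E b * exp (- K * (b - a))) \<le> exp (K * (b - a)) * (E a + \<rho> * (b - a))"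
    by (intro mult_left_mono) auto
  moreover have "exp (K * (b - a)) * (E b * exp (- K * (b - a))) = E b"
    using exp_minus_inverse[of "K * (b - a)"] by (simp add: mult_ac)
  ultimately show ?thesis by linarith
qed

text \<open>The squared norm is differentiable everywhere, also where \<open>u\<close> vanishes, so the estimate is run
  for it; the inhomogeneity is separated from \<open>u\<close> by \<open>2 * norm u * \<rho> \<le> (norm u)\<^sup>2 + \<rho>\<^sup>2\<close>.\<close>

lemma norm_growth_estimate:
  fixes u :: "real \<Rightarrow> 'a::real_inner"
  assumes "a \<le> b" and "L \<ge> 0" and "\<rho> \<ge> 0"
    and deriv: "\<And>t. (u has_vector_derivative u' t) (at t)"
    and bound: "\<And>t. a \<le> t \<Longrightarrow> t \<le> b \<Longrightarrow> norm (u' t) \<le> L * norm (u t) + \<rho>"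
  shows "(norm (u b))\<^sup>2 \<le> exp ((2 * L + 1) * (b - a)) * ((norm (u a))\<^sup>2 + \<rho>\<^sup>2 * (b - a))"
proof (rule gronwall_linear[where E = "\<lambda>t. (norm (u t))\<^sup>2" and E' = "\<lambda>t. 2 * (u t \<bullet> u' t)"])
  show "((\<lambda>t. (norm (u t))\<^sup>2) has_real_derivative 2 * (u t \<bullet> u' t)) (at t)" for t
  proof -
    have "((\<lambda>t. u t \<bullet> u t) has_derivative (\<lambda>h. u t \<bullet> (h *\<^sub>R u' t) + (h *\<^sub>R u' t) \<bullet> u t)) (at t)"
      using deriv[of t] unfolding has_vector_derivative_def by (intro has_derivative_inner)
    moreover have "(\<lambda>h. u t \<bullet> (h *\<^sub>R u' t) + (h *\<^sub>R u' t) \<bullet> u t) = (*) (2 * (u t \<bullet> u' t))"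
      by (auto simp: inner_commute)
    ultimately show ?thesis
      by (simp add: has_field_derivative_def power2_norm_eq_inner)
  qed
  show "2 * (u t \<bullet> u' t) \<le> (2 * L + 1) * (norm (u t))\<^sup>2 + \<rho>\<^sup>2" if "a \<le> t" "t \<le> b" for t
  proof -
    have "u t \<bullet> u' t \<le> norm (u t) * norm (u' t)"
      by (rule norm_cauchy_schwarz)
    also have "\<dots> \<le> norm (u t) * (L * norm (u t) + \<rho>)"
      using bound[OF that] by (intro mult_left_mono) auto
    finally have "2 * (u t \<bullet> u' t) \<le> 2 * L * (norm (u t))\<^sup>2 + 2 * norm (u t) * \<rho>"
      by (simp add: power2_eq_square algebra_simps)
    moreover have "2 * norm (u t) * \<rho> \<le> (norm (u t))\<^sup>2 + \<rho>\<^sup>2"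
      by (rule sum_squares_bound)
    ultimately show ?thesis by (simp add: algebra_simps)
  qed
qed (use assms in auto)

definition solves_ode :: "(real \<Rightarrow> 'a \<Rightarrow> 'a::real_normed_vector) \<Rightarrow> (real \<Rightarrow> 'a) \<Rightarrow> bool" where
  "solves_ode F x \<longleftrightarrow> (\<forall>t. (x has_vector_derivative F t (x t)) (at t))"

lemma solves_ode_dist:
  fixes x y :: "real \<Rightarrow> 'a::real_inner"
  assumes x: "solves_ode F x" and y: "solves_ode F y" and "a \<le> b" "L \<ge> 0"
    and lip: "\<And>t u v. norm (F t u - F t v) \<le> L * norm (u - v)"
  shows "norm (x b - y b) \<le> exp ((L + 1/2) * (b - a)) * norm (x a - y a)"
proof -
  have "(norm (x b - y b))\<^sup>2 \<le> exp ((2 * L + 1) * (b - a)) * ((norm (x a - y a))\<^sup>2 + 0\<^sup>2 * (b - a))"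
    by (rule norm_growth_estimate[where u = "\<lambda>t. x t - y t" and u' = "\<lambda>t. F t (x t) - F t (y t)"])
      (use assms in \<open>auto intro!: has_vector_derivative_diff simp: solves_ode_def\<close>)
  also have "\<dots> = (exp ((L + 1/2) * (b - a)) * norm (x a - y a))\<^sup>2"
    by (simp add: power_mult_distrib field_simps flip: exp_double)
  finally show ?thesis
    by (rule power2_le_imp_le) simp
qed

lemma solves_ode_unique:
  fixes x y :: "real \<Rightarrow> 'a::real_inner"
  assumes x: "solves_ode F x" and y: "solves_ode F y" and "L \<ge> 0"
    and lip: "\<And>t u v. norm (F t u - F t v) \<le> L * norm (u - v)"
    and eq: "x s = y s"
  shows "x = y"
proof
  fix t
  show "x t = y t"
  proof (cases "s \<le> t")
    case True
    show ?thesis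
      using solves_ode_dist[OF x y True \<open>L \<ge> 0\<close> lip] eq by simp
  next
    case False
    have refl: "solves_ode (\<lambda>t v. - F (- t) v) (\<lambda>t. z (- t))" if "solves_ode F z" for z
      unfolding solves_ode_def
    proof
      fix r
      have "((z \<circ> uminus) has_vector_derivative (- 1) *\<^sub>R F (- r) (z (- r))) (at r)"
        using that by (intro vector_diff_chain_at)
          (auto simp: solves_ode_def intro!: derivative_eq_intros)
      then show "((\<lambda>t. z (- t)) has_vector_derivative - F (- r) (z (- r))) (at r)"
        by (simp add: o_def)
    qed
    have "norm (x (- (- t)) - y (- (- t))) \<le> exp ((L + 1/2) * (- t - - s)) * norm (x (- (- s)) - y (- (- s)))"
    proof (rule solves_ode_dist[OF refl[OF x] refl[OF y]])
      show "norm (- F (- t) u - - F (- t) v) \<le> L * norm (u - v)" for t u v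
        using lip[of "- t" u v] by (simp add: norm_minus_commute)
    qed (use False \<open>L \<ge> 0\<close> in auto)
    then show ?thesis using eq by simp
  qed
qed

section \<open>Global existence\<close>

text \<open>The signed integral from \<open>0\<close> to \<open>t\<close>; the Henstock--Kurzweil integral over \<open>{0..t}\<close> alone is
  zero for negative \<open>t\<close>.\<close>

definition primitive :: "(real \<Rightarrow> 'a::banach) \<Rightarrow> real \<Rightarrow> 'a" where
  "primitive g t = (if 0 \<le> t then integral {0..t} g else - integral {t..0} g)"

lemma primitive_0 [simp]: "primitive g 0 = 0"
  by (simp add: primitive_def)

lemma primitive_has_vector_derivative:
  assumes "continuous_on UNIV g"
  shows "(primitive g has_vector_derivative g t) (at t)"
proof -
  define c where "c = \<bar>t\<bar> + 1"
  have cont: "continuous_on S g" for S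
    using assms continuous_on_subset by blast
  have eq: "integral {- c..u} g - integral {- c..0} g = primitive g u" if "u \<in> {- c<..<c}" for u
  proof (cases "0 \<le> u")
    case True
    have "integral {- c..0} g + integral {0..u} g = integral {- c..u} g"
      using that True by (intro Henstock_Kurzweil_Integration.integral_combine integrable_continuous_interval cont)
        (auto simp: c_def)
    then show ?thesis using True by (simp add: primitive_def algebra_simps)
  next
    case False
    have "integral {- c..u} g + integral {u..0} g = integral {- c..0} g"
      using that False by (intro Henstock_Kurzweil_Integration.integral_combine integrable_continuous_interval cont)
        (auto simp: c_def)
    then show ?thesis using False by (simp add: primitive_def algebra_simps)
  qed
  have "((\<lambda>u. integral {- c..u} g) has_vector_derivative g t) (at t within {- c..c})"
    by (rule integral_has_vector_derivative[OF cont]) (auto simp: c_def)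
  then have "((\<lambda>u. integral {- c..u} g) has_vector_derivative g t) (at t)"
    by (subst (asm) at_within_interior) (auto simp: c_def)
  then have "((\<lambda>u. integral {- c..u} g - integral {- c..0} g) has_vector_derivative g t) (at t)"
    using has_vector_derivative_diff[OF _ has_vector_derivative_const] by fastforce
  then show ?thesis
    by (rule has_vector_derivative_transform_within_open[where S = "{- c<..<c}"])
      (use eq in \<open>auto simp: c_def\<close>)
qed

lemma primitive_norm_bound:
  assumes g: "continuous_on UNIV g" and "K > 0" "M \<ge> 0"
    and bound: "\<And>s. norm (g s) \<le> M * exp (K * \<bar>s\<bar>)"
  shows "norm (primitive g t) \<le> M / K * exp (K * \<bar>t\<bar>)"
proof -
  have aux: "norm (h r) \<le> M / K * exp (K * r)"
    if "r \<ge> 0" and h: "\<And>s. (h has_vector_derivative h' s) (at s)" and "h 0 = 0"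
      and h': "\<And>s. norm (h' s) \<le> M * exp (K * \<bar>s\<bar>)" for h h' :: "real \<Rightarrow> 'a" and r
  proof (cases "r = 0")
    case True
    then show ?thesis using that \<open>K > 0\<close> \<open>M \<ge> 0\<close> by simp
  next
    case False
    have "norm (h r - h 0) \<le> M / K * exp (K * r) - M / K * exp (K * 0)"
    proof (rule differentiable_bound_general[where f' = h' and \<phi>' = "\<lambda>s. M * exp (K * s)"])
      show "continuous_on {0..r} h"
        using h by (meson continuous_at_imp_continuous_on has_vector_derivative_continuous)
      show "((\<lambda>s. M / K * exp (K * s)) has_vector_derivative M * exp (K * s)) (at s)" for s
        unfolding has_real_derivative_iff_has_vector_derivative[symmetric]
        using \<open>K > 0\<close> by (auto intro!: derivative_eq_intros)
      show "norm (h' s) \<le> M * exp (K * s)" if "0 < s" for s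
        using h'[of s] that by simp
    qed (use False that h \<open>K > 0\<close> in \<open>auto intro!: continuous_intros\<close>)
    moreover have "M / K * exp (K * 0) \<ge> 0" using \<open>K > 0\<close> \<open>M \<ge> 0\<close> by simp
    ultimately show ?thesis using \<open>h 0 = 0\<close> by simp
  qed
  show ?thesis
  proof (cases "t \<ge> 0")
    case True
    then show ?thesis
      using aux[OF True primitive_has_vector_derivative[OF g] _ bound] by simp
  next
    case False
    have "((\<lambda>s. primitive g (- s)) has_vector_derivative - g (- s)) (at s)" for s
    proof -
      have "((primitive g \<circ> uminus) has_vector_derivative (- 1) *\<^sub>R g (- s)) (at s)"
        by (intro vector_diff_chain_at primitive_has_vector_derivative g)
          (auto intro!: derivative_eq_intros)
      then show ?thesis by (simp add: o_def)
    qed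
    from aux[OF _ this, of "- t"] show ?thesis
      using False bound[of "- s" for s] by simp
  qed
qed

text \<open>Picard iteration on the whole line at once. A solution is sought in the form
  \<open>x t = x0 + exp (K * \<bar>t\<bar>) * v t\<close> with \<open>v\<close> bounded and continuous. In terms of \<open>v\<close> the integral
  equation is a fixed point problem on a complete space, and the exponential weight turns the
  Lipschitz constant \<open>L\<close> of the field into the contraction factor \<open>L / K\<close>, which is below one
  because \<open>K = 2 * L + 1\<close>.\<close>

theorem ode_global_existence:
  fixes F :: "real \<Rightarrow> 'a::banach \<Rightarrow> 'a"
  assumes cont: "continuous_on UNIV (\<lambda>(t, v). F t v)" and "L \<ge> 0"
    and lip: "\<And>t u v. norm (F t u - F t v) \<le> L * norm (u - v)"
    and bdd: "\<And>t. norm (F t x0) \<le> M"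
  obtains x where "solves_ode F x" and "x 0 = x0"
proof -
  define K where "K = 2 * L + 1"
  have "K > 0" using \<open>L \<ge> 0\<close> by (simp add: K_def)
  have "M \<ge> 0" using bdd[of 0] norm_ge_zero order_trans by blast
  define g where "g v s = F s (x0 + exp (K * \<bar>s\<bar>) *\<^sub>R apply_bcontfun v s)"
    for v :: "real \<Rightarrow>\<^sub>C 'a" and s
  have g_cont: "continuous_on UNIV (g v)" for v
    unfolding g_def
    by (rule continuous_on_compose2[OF cont, of UNIV "\<lambda>s. (s, x0 + exp (K * \<bar>s\<bar>) *\<^sub>R apply_bcontfun v s)", simplified])
      (auto intro!: continuous_intros)
  have g_bound: "norm (g v s) \<le> (M + L * norm v) * exp (K * \<bar>s\<bar>)" for v s
  proof -
    have "norm (g v s) \<le> norm (F s x0) + norm (g v s - F s x0)"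
      by (metis add.commute diff_add_cancel norm_triangle_ineq)
    also have "\<dots> \<le> M + L * (exp (K * \<bar>s\<bar>) * norm (apply_bcontfun v s))"
      using lip[of s "x0 + exp (K * \<bar>s\<bar>) *\<^sub>R apply_bcontfun v s" x0] bdd[of s]
      by (simp add: g_def)
    also have "\<dots> \<le> M * exp (K * \<bar>s\<bar>) + L * (exp (K * \<bar>s\<bar>) * norm v)"
      using \<open>K > 0\<close> \<open>M \<ge> 0\<close> \<open>L \<ge> 0\<close> norm_bounded[of v s]
      by (intro add_mono mult_left_mono) (auto simp: mult_le_cancel_left1)
    finally show ?thesis by (simp add: algebra_simps)
  qed
  define \<Phi> where "\<Phi> v t = exp (- K * \<bar>t\<bar>) *\<^sub>R primitive (g v) t" for v t
  have \<Phi>: "\<Phi> v \<in> bcontfun" for v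
  proof (rule bcontfun_normI)
    have "continuous_on UNIV (primitive (g v))"
      using primitive_has_vector_derivative[OF g_cont]
      by (meson continuous_at_imp_continuous_on has_vector_derivative_continuous)
    then show "continuous_on UNIV (\<Phi> v)"
      unfolding \<Phi>_def by (intro continuous_intros)
    fix t
    have "norm (\<Phi> v t) \<le> exp (- K * \<bar>t\<bar>) * ((M + L * norm v) / K * exp (K * \<bar>t\<bar>))"
      unfolding \<Phi>_def norm_scaleR using \<open>K > 0\<close> \<open>M \<ge> 0\<close> \<open>L \<ge> 0\<close>
      by (intro mult_mono primitive_norm_bound g_cont g_bound) auto
    also have "\<dots> = (M + L * norm v) / K"
      by (simp add: exp_minus)
    finally show "norm (\<Phi> v t) \<le> (M + L * norm v) / K" .
  qed
  have contraction: "dist (Bcontfun (\<Phi> v)) (Bcontfun (\<Phi> w)) \<le> L / K * dist v w" for v w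
  proof (rule dist_bound)
    fix t
    have prim: "primitive (g v) t - primitive (g w) t = primitive (\<lambda>s. g v s - g w s) t"
      unfolding primitive_def
      by (auto intro!: Henstock_Kurzweil_Integration.integral_diff[symmetric] integrable_continuous_interval
            continuous_on_subset[OF g_cont]
          simp: Henstock_Kurzweil_Integration.integral_diff integrable_continuous_interval
            continuous_on_subset[OF g_cont])
    have "norm (primitive (\<lambda>s. g v s - g w s) t) \<le> (L * dist v w) / K * exp (K * \<bar>t\<bar>)"
    proof (rule primitive_norm_bound)
      show "continuous_on UNIV (\<lambda>s. g v s - g w s)"
        by (intro continuous_intros g_cont)
      show "norm (g v s - g w s) \<le> L * dist v w * exp (K * \<bar>s\<bar>)" for s
      proof -
        have "norm (g v s - g w s) \<le> L * (exp (K * \<bar>s\<bar>) * dist (apply_bcontfun v s) (apply_bcontfun w s))"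
          using lip[of s "x0 + exp (K * \<bar>s\<bar>) *\<^sub>R apply_bcontfun v s" "x0 + exp (K * \<bar>s\<bar>) *\<^sub>R apply_bcontfun w s"]
          by (simp add: g_def dist_norm flip: scaleR_diff_right)
        also have "\<dots> \<le> L * (exp (K * \<bar>s\<bar>) * dist v w)"
          using \<open>L \<ge> 0\<close> by (intro mult_left_mono dist_bounded) auto
        finally show ?thesis by (simp add: algebra_simps)
      qed
    qed (use \<open>K > 0\<close> \<open>L \<ge> 0\<close> in auto)
    then have "exp (- K * \<bar>t\<bar>) * norm (primitive (\<lambda>s. g v s - g w s) t)
        \<le> exp (- K * \<bar>t\<bar>) * ((L * dist v w) / K * exp (K * \<bar>t\<bar>))"
      by (intro mult_left_mono) auto
    also have "\<dots> = L / K * dist v w"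
      by (simp add: exp_minus field_simps)
    finally show "dist (apply_bcontfun (Bcontfun (\<Phi> v)) t) (apply_bcontfun (Bcontfun (\<Phi> w)) t)
        \<le> L / K * dist v w"
      by (simp add: Bcontfun_inverse[OF \<Phi>] dist_norm \<Phi>_def prim flip: scaleR_diff_right)
  qed
  have "\<exists>!v. Bcontfun (\<Phi> v) = v"
    using \<open>L \<ge> 0\<close> \<open>K > 0\<close> contraction
    by (intro banach_fix_type[of "L / K"]) (auto simp: K_def)
  then obtain v where v: "Bcontfun (\<Phi> v) = v" by blast
  define x where "x t = x0 + primitive (g v) t" for t
  have "apply_bcontfun v t = exp (- K * \<bar>t\<bar>) *\<^sub>R primitive (g v) t" for t
    using Bcontfun_inverse[OF \<Phi>[of v]] v by (simp add: \<Phi>_def)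
  then have "F t (x t) = g v t" for t
    by (simp add: g_def x_def flip: exp_add)
  then have "solves_ode F x"
    unfolding solves_ode_def x_def
    using primitive_has_vector_derivative[OF g_cont[of v]]
    by (auto intro!: derivative_eq_intros)
  moreover have "x 0 = x0" by (simp add: x_def)
  ultimately show thesis using that by blast
qed

section \<open>Differentiability in the initial value\<close>

text \<open>The defect \<open>u = y h - y c - (h - c) *\<^sub>R \<zeta>\<close> starts at zero and satisfies the linearised equation
  up to the Taylor remainder of \<open>F\<close>. Since \<open>y h - y c\<close> is of order \<open>h - c\<close> on \<open>{0..T}\<close>, the
  remainder is of order \<open>(h - c)\<^sup>2\<close>, and by the growth estimate so is the defect at time \<open>T\<close>.\<close>

lemma flow_has_vector_derivative:
  fixes F :: "real \<Rightarrow> 'a::real_inner \<Rightarrow> 'a" and y :: "real \<Rightarrow> real \<Rightarrow> 'a"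
  assumes y: "\<And>h. solves_ode F (y h)" and y0: "\<And>h. y h 0 = y c 0 + (h - c) *\<^sub>R \<zeta> 0"
    and \<zeta>: "solves_ode (\<lambda>t v. A t v) \<zeta>"
    and A: "\<And>t. linear (A t)" "\<And>t v. norm (A t v) \<le> L * norm v" and "L \<ge> 0"
    and lip: "\<And>t u v. norm (F t u - F t v) \<le> L * norm (u - v)"
    and rem: "\<And>t v. norm (F t v - F t (y c t) - A t (v - y c t)) \<le> M * (norm (v - y c t))\<^sup>2"
    and "M \<ge> 0" "T \<ge> 0"
  shows "((\<lambda>h. y h T) has_vector_derivative \<zeta> T) (at c)"
proof -
  define B where "B = exp ((L + 1/2) * T) * norm (\<zeta> 0)"
  define C where "C = sqrt (exp ((2 * L + 1) * T) * (M * B\<^sup>2)\<^sup>2 * T)"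
  have est: "norm (y h T - y c T - (h - c) *\<^sub>R \<zeta> T) \<le> C * (h - c)\<^sup>2" for h
  proof -
    define u where "u t = y h t - y c t - (h - c) *\<^sub>R \<zeta> t" for t
    define u' where "u' t = F t (y h t) - F t (y c t) - (h - c) *\<^sub>R A t (\<zeta> t)" for t
    have dist: "norm (y h t - y c t) \<le> B * \<bar>h - c\<bar>" if "0 \<le> t" "t \<le> T" for t
    proof -
      have "norm (y h t - y c t) \<le> exp ((L + 1/2) * (t - 0)) * norm (y h 0 - y c 0)"
        by (rule solves_ode_dist[OF y y]) (use that \<open>L \<ge> 0\<close> lip in auto)
      also have "\<dots> \<le> exp ((L + 1/2) * T) * norm (y h 0 - y c 0)"
        using that \<open>L \<ge> 0\<close> by (intro mult_right_mono) (auto intro!: mult_left_mono)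
      also have "norm (y h 0 - y c 0) = \<bar>h - c\<bar> * norm (\<zeta> 0)"
        using y0[of h] by simp
      finally show ?thesis by (simp add: B_def mult_ac)
    qed
    have "(norm (u T))\<^sup>2 \<le> exp ((2 * L + 1) * (T - 0)) *
        ((norm (u 0))\<^sup>2 + (M * (B * \<bar>h - c\<bar>)\<^sup>2)\<^sup>2 * (T - 0))"
    proof (rule norm_growth_estimate[where u' = u'])
      show "(u has_vector_derivative u' t) (at t)" for t
        unfolding u_def u'_def using y[of h] y[of c] \<zeta>
        by (auto simp: solves_ode_def intro!: has_vector_derivative_diff derivative_eq_intros)
      show "norm (u' t) \<le> L * norm (u t) + M * (B * \<bar>h - c\<bar>)\<^sup>2" if "0 \<le> t" "t \<le> T" for t
      proof -
        have "u' t = A t (u t) + (F t (y h t) - F t (y c t) - A t (y h t - y c t))"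
          unfolding u_def u'_def using A(1)[of t] by (simp add: linear_diff linear_scale)
        then have "norm (u' t) \<le> L * norm (u t) + M * (norm (y h t - y c t))\<^sup>2"
          using A(2)[of t "u t"] rem[of t "y h t"]
          by (metis (no_types, lifting) add_mono norm_triangle_le)
        also have "\<dots> \<le> L * norm (u t) + M * (B * \<bar>h - c\<bar>)\<^sup>2"
          using dist[OF that] \<open>M \<ge> 0\<close> by (intro add_left_mono mult_left_mono power_mono) auto
        finally show ?thesis .
      qed
    qed (use \<open>T \<ge> 0\<close> \<open>L \<ge> 0\<close> \<open>M \<ge> 0\<close> in auto)
    also have "u 0 = 0" using y0[of h] by (simp add: u_def)
    also have "exp ((2 * L + 1) * (T - 0)) * ((norm (0::'a))\<^sup>2 + (M * (B * \<bar>h - c\<bar>)\<^sup>2)\<^sup>2 * (T - 0))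
        = (exp ((2 * L + 1) * T) * (M * B\<^sup>2)\<^sup>2 * T) * ((h - c)\<^sup>2)\<^sup>2"
      by (simp add: power_mult_distrib)
    also have "\<dots> = (C * (h - c)\<^sup>2)\<^sup>2"
      using \<open>T \<ge> 0\<close> by (simp add: C_def power_mult_distrib)
    finally have "norm (u T) \<le> C * (h - c)\<^sup>2"
      by (rule power2_le_imp_le) (use \<open>T \<ge> 0\<close> in \<open>simp add: C_def\<close>)
    then show ?thesis by (simp add: u_def)
  qed
  have "((\<lambda>h. norm (y h T - y c T - (h - c) *\<^sub>R \<zeta> T) / norm (h - c)) \<longlongrightarrow> 0) (at c)"
  proof (rule tendsto_sandwich[of "\<lambda>_. 0" _ _ "\<lambda>h. C * \<bar>h - c\<bar>"])
    show "\<forall>\<^sub>F h in at c. norm (y h T - y c T - (h - c) *\<^sub>R \<zeta> T) / norm (h - c) \<le> C * \<bar>h - c\<bar>"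
    proof (rule always_eventually, rule allI)
      fix h
      show "norm (y h T - y c T - (h - c) *\<^sub>R \<zeta> T) / norm (h - c) \<le> C * \<bar>h - c\<bar>"
      proof (cases "h = c")
        case False
        then show ?thesis using est[of h]
          by (simp add: divide_le_eq power2_eq_square mult.assoc flip: abs_mult)
      qed simp
    qed
    show "((\<lambda>h. C * \<bar>h - c\<bar>) \<longlongrightarrow> 0) (at c)"
      by (auto intro!: tendsto_eq_intros)
  qed auto
  then show ?thesis
    unfolding has_vector_derivative_def
    by (simp only: has_derivative_iff_norm bounded_linear_scaleR_left simp_thms)
qed

section \<open>A Sturm comparison argument\<close>

lemma quotient_tendsto_quotient_of_derivs:
  fixes f g :: "real \<Rightarrow> real"
  assumes "(f has_real_derivative f') (at x)" "(g has_real_derivative g') (at x)"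
    and "f x = 0" "g x = 0" "g' \<noteq> 0"
  shows "((\<lambda>t. f t / g t) \<longlongrightarrow> f' / g') (at x)"
proof -
  have "((\<lambda>t. (f t - f x) / (t - x) / ((g t - g x) / (t - x))) \<longlongrightarrow> f' / g') (at x)"
    using assms by (intro tendsto_divide) (auto simp: has_field_derivative_iff)
  then show ?thesis
    by (rule Lim_transform_eventually)
      (use assms in \<open>auto intro!: eventually_mono[OF eventually_neq_at_within[of x]]\<close>)
qed

text \<open>Comparison with \<open>sin (\<omega> * t)\<close>, \<open>\<omega> = pi / T\<close>, the solution of the extremal equation \<open>w = 1\<close>,
  \<open>c = \<omega>\<^sup>2\<close>, whose first zero is exactly at \<open>T\<close>. With \<open>v = \<omega> * cot (\<omega> * t)\<close>, its logarithmic
  derivative, Picone's identity reads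
  \<open>(\<xi> * \<eta> - \<xi>\<^sup>2 * v)' = w * (\<eta> - \<xi> * v)\<^sup>2 + (1 - w) * (\<xi> * v)\<^sup>2 + (\<omega>\<^sup>2 - c) * \<xi>\<^sup>2\<close>,
  a sum of nonnegative terms. If \<open>\<xi>\<close> had a zero \<open>\<tau>\<close> in \<open>(0, T]\<close>, the function on the left would
  vanish at \<open>0\<close> and at \<open>\<tau>\<close>, hence in between, and all three terms on the right would vanish there. For
  \<open>\<tau> < T\<close> this contradicts the slope \<open>w * \<eta>\<^sup>2 > 0\<close> of that function at \<open>\<tau>\<close>; for \<open>\<tau> = T\<close> it forces
  \<open>c = \<omega>\<^sup>2\<close> on \<open>(0, T)\<close>, and \<open>w = 1\<close> there except at \<open>T / 2\<close>, where \<open>v\<close> vanishes.\<close>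

theorem sturm_positive:
  fixes \<xi> \<eta> w c :: "real \<Rightarrow> real"
  assumes "T > 0"
    and \<xi>': "\<And>t. (\<xi> has_real_derivative w t * \<eta> t) (at t)"
    and \<eta>': "\<And>t. (\<eta> has_real_derivative - c t * \<xi> t) (at t)"
    and nontrivial: "\<And>t. \<xi> t \<noteq> 0 \<or> \<eta> t \<noteq> 0"
    and init: "\<xi> 0 = 0" "\<eta> 0 > 0"
    and w: "\<And>t. 0 < w t" "\<And>t. w t \<le> 1"
    and c: "\<And>t. c t \<le> (pi / T)\<^sup>2"
    and strict: "\<exists>t\<in>{0<..<T}. t \<noteq> T / 2 \<and> (w t < 1 \<or> c t < (pi / T)\<^sup>2)"
  shows "\<xi> T > 0"
proof (rule ccontr)
  define \<omega> where "\<omega> = pi / T"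
  have "\<omega> > 0" and \<omega>T: "\<omega> * T = pi" using \<open>T > 0\<close> by (simp_all add: \<omega>_def)
  have \<omega>t: "0 < \<omega> * t" "\<omega> * t < pi" if "0 < t" "t < T" for t
    using that \<open>\<omega> > 0\<close> \<omega>T mult_strict_left_mono[of t T \<omega>] by auto
  assume "\<not> \<xi> T > 0"
  obtain d where "d > 0" and d: "\<And>h. 0 < h \<Longrightarrow> h < d \<Longrightarrow> \<xi> 0 < \<xi> (0 + h)"
    using DERIV_pos_inc_right[OF \<xi>'[of 0]] init w(1)[of 0] by auto
  define s where "s = min (d / 2) T"
  have s: "0 < s" "s \<le> T" "\<xi> s > 0"
    using d[of s] \<open>d > 0\<close> \<open>T > 0\<close> init by (auto simp: s_def)
  have "continuous_on {s..T} \<xi>"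
    using \<xi>' by (intro continuous_at_imp_continuous_on) (auto intro: DERIV_isCont)
  then obtain \<tau> where "s \<le> \<tau>" "\<tau> \<le> T" and \<tau>0: "\<xi> \<tau> = 0"
    using IVT2'[of \<xi> T 0 s] s \<open>\<not> \<xi> T > 0\<close> by auto
  then have "\<tau> > 0" using s by simp
  define v where "v t = \<omega> * cos (\<omega> * t) / sin (\<omega> * t)" for t
  define \<Phi> where "\<Phi> t = \<xi> t * \<eta> t - (\<xi> t)\<^sup>2 * v t" for t
  define D where "D t = w t * (\<eta> t - \<xi> t * v t)\<^sup>2 + (1 - w t) * (\<xi> t * v t)\<^sup>2
      + (\<omega>\<^sup>2 - c t) * (\<xi> t)\<^sup>2" for t
  have D_nonneg: "D t \<ge> 0" for t
    using w[of t] c[of t] by (simp add: D_def \<omega>_def)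
  have \<Phi>': "(\<Phi> has_real_derivative D t) (at t)" if "0 < t" "t < T" for t
  proof -
    have sin: "sin (\<omega> * t) > 0"
      using \<omega>t[OF that] by (rule sin_gt_zero)
    have v': "(v has_real_derivative - (\<omega>\<^sup>2 + (v t)\<^sup>2)) (at t)"
      unfolding v_def[abs_def] using sin
      by (auto intro!: derivative_eq_intros simp: power2_eq_square divide_simps algebra_simps)
    show ?thesis
      unfolding \<Phi>_def
      by (rule derivative_eq_intros refl \<xi>' \<eta>' v')+
        (simp add: D_def power2_eq_square algebra_simps)
  qed
  \<comment> \<open>At a multiple of \<open>T\<close>, where the cotangent has a pole, \<open>v t\<close> is zero because division by zero
    is; the double zero of \<open>\<xi>\<^sup>2\<close> against the simple pole makes that value the limit.\<close>
  have \<Phi>_cont_endpoint: "isCont \<Phi> t" if "\<xi> t = 0" "sin (\<omega> * t) = 0" for t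
  proof -
    have cos: "cos (\<omega> * t) \<noteq> 0" using that(2) sin_zero_abs_cos_one by fastforce
    have "((\<lambda>t. \<xi> t / sin (\<omega> * t)) \<longlongrightarrow> w t * \<eta> t / (\<omega> * cos (\<omega> * t))) (at t)"
      using that cos \<open>\<omega> > 0\<close>
      by (intro quotient_tendsto_quotient_of_derivs \<xi>') (auto intro!: derivative_eq_intros)
    note quot = this
    have \<xi>0: "(\<xi> \<longlongrightarrow> 0) (at t)" and \<eta>t: "(\<eta> \<longlongrightarrow> \<eta> t) (at t)"
      using DERIV_isCont[OF \<xi>'[of t]] DERIV_isCont[OF \<eta>'[of t]] that by (simp_all add: isCont_def)
    have cos_lim: "((\<lambda>t. \<omega> * cos (\<omega> * t)) \<longlongrightarrow> \<omega> * cos (\<omega> * t)) (at t)"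
      by (intro tendsto_intros)
    have "((\<lambda>t. \<xi> t * \<eta> t - \<xi> t * (\<xi> t / sin (\<omega> * t)) * (\<omega> * cos (\<omega> * t))) \<longlongrightarrow>
        0 * \<eta> t - 0 * (w t * \<eta> t / (\<omega> * cos (\<omega> * t))) * (\<omega> * cos (\<omega> * t))) (at t)"
      by (rule tendsto_diff[OF tendsto_mult[OF \<xi>0 \<eta>t] tendsto_mult[OF tendsto_mult[OF \<xi>0 quot] cos_lim]])
    then show ?thesis
      using that by (simp add: isCont_def \<Phi>_def[abs_def] v_def power2_eq_square mult_ac)
  qed
  have "isCont \<Phi> t" if "0 \<le> t" "t \<le> \<tau>" for t
  proof (cases "0 < t \<and> t < T")
    case True
    then show ?thesis using \<Phi>' DERIV_isCont by blast
  next
    case False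
    then have "t = 0 \<or> t = T \<and> \<tau> = T" using that \<open>\<tau> \<le> T\<close> by auto
    then show ?thesis using \<Phi>_cont_endpoint init \<tau>0 \<omega>T by auto
  qed
  then have cont: "continuous_on {a..b} \<Phi>" if "0 \<le> a" "b \<le> \<tau>" for a b
    using that by (auto intro!: continuous_at_imp_continuous_on)
  have zero: "\<Phi> t = 0" if t: "0 < t" "t < \<tau>" for t
  proof -
    have mono: "\<Phi> a \<le> \<Phi> b" if "0 \<le> a" "a \<le> b" "b \<le> \<tau>" for a b
    proof (rule DERIV_nonneg_imp_increasing_open[OF that(2) _ cont[OF that(1,3)]])
      fix r assume "a < r" "r < b"
      then show "\<exists>y. (\<Phi> has_real_derivative y) (at r) \<and> 0 \<le> y"
        using that \<open>\<tau> \<le> T\<close> \<Phi>'[of r] D_nonneg[of r] by auto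
    qed
    have "\<Phi> 0 \<le> \<Phi> t" "\<Phi> t \<le> \<Phi> \<tau>"
      using t by (simp_all add: mono)
    then show ?thesis using init \<tau>0 by (simp add: \<Phi>_def)
  qed
  show False
  proof (cases "\<tau> < T")
    case True
    \<comment> \<open>The derivative at \<open>\<tau>\<close> is positive, yet \<open>\<Phi>\<close> is zero to the left of \<open>\<tau>\<close>.\<close>
    have "D \<tau> > 0"
      using nontrivial[of \<tau>] \<tau>0 w(1)[of \<tau>] by (simp add: D_def)
    then obtain e where "e > 0" and e: "\<And>h. 0 < h \<Longrightarrow> h < e \<Longrightarrow> \<Phi> (\<tau> - h) < \<Phi> \<tau>"
      using DERIV_pos_inc_left[OF \<Phi>'[OF \<open>\<tau> > 0\<close> True]] by auto
    define h where "h = min (e / 2) (\<tau> / 2)"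
    have "0 < h" "h < e" "h < \<tau>" using \<open>e > 0\<close> \<open>\<tau> > 0\<close> by (auto simp: h_def)
    then show False
      using e[of h] zero[of "\<tau> - h"] \<tau>0 by (simp add: \<Phi>_def)
  next
    case False
    then have "\<tau> = T" using \<open>\<tau> \<le> T\<close> by simp
    obtain t where t: "0 < t" "t < T" "t \<noteq> T / 2" and t': "w t < 1 \<or> c t < \<omega>\<^sup>2"
      using strict by (auto simp: \<omega>_def)
    have "(\<Phi> has_real_derivative 0) (at t)"
      by (rule has_field_derivative_transform_within_open[where S = "{0<..<T}" and f = "\<lambda>_. 0"])
        (use t zero \<open>\<tau> = T\<close> in auto)
    then have "D t = 0" using \<Phi>'[of t] t DERIV_unique by blast
    moreover have "w t * (\<eta> t - \<xi> t * v t)\<^sup>2 \<ge> 0" "(1 - w t) * (\<xi> t * v t)\<^sup>2 \<ge> 0"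
      "(\<omega>\<^sup>2 - c t) * (\<xi> t)\<^sup>2 \<ge> 0"
      using w[of t] c[of t] by (simp_all add: \<omega>_def)
    ultimately have "w t * (\<eta> t - \<xi> t * v t)\<^sup>2 = 0" and w0: "(1 - w t) * (\<xi> t * v t)\<^sup>2 = 0"
      and c0: "(\<omega>\<^sup>2 - c t) * (\<xi> t)\<^sup>2 = 0"
      unfolding D_def by linarith+
    then have "\<eta> t = \<xi> t * v t" using w(1)[of t] by simp
    then have "\<xi> t \<noteq> 0" using nontrivial[of t] by (metis mult_zero_left)
    moreover have "cos (\<omega> * t) \<noteq> 0"
    proof
      assume "cos (\<omega> * t) = 0"
      then have "\<omega> * t = pi / 2"
        using \<omega>t[OF t(1,2)] \<open>cos (\<omega> * t) = 0\<close> cos_inj_pi[of "\<omega> * t" "pi / 2"] by simp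
      then have "\<omega> * (2 * t) = \<omega> * T" using \<omega>T by simp
      then show False using \<open>\<omega> > 0\<close> t(3) by auto
    qed
    then have "v t \<noteq> 0"
      using \<open>\<omega> > 0\<close> sin_gt_zero[OF \<omega>t[OF t(1,2)]] by (simp add: v_def)
    ultimately show False using w0 c0 t' by auto
  qed
qed

section \<open>The relativistic velocity\<close>

lemma quadratic_remainder:
  fixes f f' :: "real \<Rightarrow> real"
  assumes deriv: "\<And>x. (f has_real_derivative f' x) (at x)"
    and lip: "\<And>x y. \<bar>f' x - f' y\<bar> \<le> K * \<bar>x - y\<bar>" and "K \<ge> 0"
  shows "\<bar>f y - f x - f' x * (y - x)\<bar> \<le> K * (y - x)\<^sup>2"
proof -
  obtain z where z: "f y - f x = (y - x) * f' z" "\<bar>z - x\<bar> \<le> \<bar>y - x\<bar>"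
  proof (cases x y rule: linorder_cases)
    case less
    then show ?thesis using MVT2[OF less, of f f'] deriv that by fastforce
  next
    case greater
    then obtain z where "y < z" "z < x" "f x - f y = (x - y) * f' z"
      using MVT2[OF greater, of f f'] deriv by blast
    then show ?thesis using that[of z] by (simp add: algebra_simps)
  qed (use that in auto)
  have "\<bar>f y - f x - f' x * (y - x)\<bar> = \<bar>y - x\<bar> * \<bar>f' z - f' x\<bar>"
    using z(1) by (simp add: algebra_simps flip: abs_mult)
  also have "\<dots> \<le> \<bar>y - x\<bar> * (K * \<bar>y - x\<bar>)"
    using z(2) lip[of z x] \<open>K \<ge> 0\<close>
    by (intro mult_left_mono) (auto intro: order_trans mult_left_mono)
  finally show ?thesis by (simp add: power2_eq_square mult_ac flip: abs_mult)
qed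

lemma abs_diff_le_of_deriv_bound:
  fixes f f' :: "real \<Rightarrow> real"
  assumes "\<And>x. (f has_real_derivative f' x) (at x)" "\<And>x. \<bar>f' x\<bar> \<le> K"
  shows "\<bar>f x - f y\<bar> \<le> K * \<bar>x - y\<bar>"
  using field_differentiable_bound[of UNIV f f' K x y] assms by auto

definition velocity :: "real \<Rightarrow> real" where "velocity p = p / sqrt (p\<^sup>2 + 1)"

definition velocity' :: "real \<Rightarrow> real" where "velocity' p = 1 / sqrt (p\<^sup>2 + 1) ^ 3"

lemma sq_plus_1_pos: "0 < p\<^sup>2 + (1::real)"
  by (rule add_nonneg_pos) auto

lemma sqrt_sq_plus_1_ge: "sqrt (p\<^sup>2 + 1) \<ge> 1" "sqrt (p\<^sup>2 + 1) \<ge> \<bar>p\<bar>"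
  by (auto intro: real_le_rsqrt)

lemma velocity'_pos: "velocity' p > 0"
  by (simp add: velocity'_def sq_plus_1_pos)

lemma velocity'_le_1: "velocity' p \<le> 1"
  using one_le_power[OF sqrt_sq_plus_1_ge(1)[of p], of 3] by (simp add: velocity'_def divide_le_eq sq_plus_1_pos)

lemma velocity'_eq_1: "velocity' p = 1 \<longleftrightarrow> p = 0"
proof
  assume *: "velocity' p = 1"
  show "p = 0"
  proof (rule ccontr)
    assume "p \<noteq> 0"
    then have "1 < sqrt (p\<^sup>2 + 1)" by (simp add: real_less_rsqrt)
    then have "1 < sqrt (p\<^sup>2 + 1) ^ 3" by (simp add: one_less_power)
    then show False using * by (simp add: velocity'_def)
  qed
qed (simp add: velocity'_def)

lemma sqrt_sq_plus_1_has_derivative: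
  "((\<lambda>p. sqrt (p\<^sup>2 + 1)) has_real_derivative p / sqrt (p\<^sup>2 + 1)) (at p)"
proof -
  have "((\<lambda>p. p\<^sup>2 + 1) has_real_derivative 2 * p) (at p)"
    by (auto intro!: derivative_eq_intros)
  then have "(sqrt \<circ> (\<lambda>p. p\<^sup>2 + 1) has_real_derivative inverse (sqrt (p\<^sup>2 + 1)) / 2 * (2 * p)) (at p)"
    by (rule DERIV_chain[rotated]) (rule DERIV_real_sqrt[OF sq_plus_1_pos])
  then show ?thesis
    by (simp add: o_def inverse_eq_divide)
qed

lemma velocity_has_derivative: "(velocity has_real_derivative velocity' p) (at p)"
proof -
  define s where "s p = sqrt (p\<^sup>2 + 1)" for p :: real
  have s': "(s has_real_derivative p / s p) (at p)"
    using sqrt_sq_plus_1_has_derivative by (simp add: s_def[abs_def])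
  have s: "s p > 0" "(s p)\<^sup>2 = p\<^sup>2 + 1" using sq_plus_1_pos[of p] by (simp_all add: s_def)
  have v: "velocity = (\<lambda>p. p / s p)"
    by (simp add: s_def velocity_def fun_eq_iff)
  have "(velocity has_real_derivative (1 * s p - p * (p / s p)) / (s p * s p)) (at p)"
    unfolding v by (rule DERIV_divide[OF DERIV_ident s']) (use s(1) in simp)
  moreover have "(1 * s p - p * (p / s p)) / (s p * s p) = velocity' p"
  proof -
    have "(1 * s p - p * (p / s p)) / (s p * s p) = ((s p)\<^sup>2 - p\<^sup>2) / s p ^ 3"
      using s(1) by (simp add: divide_simps power2_eq_square power3_eq_cube)
    also have "\<dots> = 1 / s p ^ 3" unfolding s(2) by simp
    finally show ?thesis by (simp only: velocity'_def s_def)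
  qed
  ultimately show ?thesis by (rule DERIV_cong)
qed

lemma velocity'_lipschitz: "\<bar>velocity' x - velocity' y\<bar> \<le> 3 * \<bar>x - y\<bar>"
proof -
  define r where "r p = inverse (sqrt (p\<^sup>2 + 1))" for p :: real
  have eq: "velocity' = (\<lambda>p. r p ^ 3)"
    by (simp add: velocity'_def r_def fun_eq_iff power_inverse divide_inverse)
  have deriv: "((\<lambda>p. r p ^ 3) has_real_derivative
      of_nat 3 * (- (r p * (p / sqrt (p\<^sup>2 + 1)) * r p) * r p ^ (3 - Suc 0))) (at p)" for p
    unfolding r_def
    by (rule DERIV_power[OF DERIV_inverse'[OF sqrt_sq_plus_1_has_derivative]])
      (use sq_plus_1_pos[of p] in simp)
  have bound: "\<bar>of_nat 3 * (- (r p * (p / sqrt (p\<^sup>2 + 1)) * r p) * r p ^ (3 - Suc 0))\<bar> \<le> 3" for p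
  proof -
    have r: "0 \<le> r p" "r p \<le> 1"
      using sqrt_sq_plus_1_ge(1)[of p] by (simp_all add: r_def inverse_le_1_iff)
    have "\<bar>p / sqrt (p\<^sup>2 + 1)\<bar> \<le> 1"
      using sqrt_sq_plus_1_ge(2)[of p] sq_plus_1_pos[of p] by (simp add: divide_le_eq)
    moreover have "r p ^ 4 \<le> 1" using r by (rule power_le_one)
    ultimately have "r p ^ 4 * \<bar>p / sqrt (p\<^sup>2 + 1)\<bar> \<le> 1"
      using r by (intro mult_le_one) auto
    moreover have "\<bar>of_nat 3 * (- (r p * c * r p) * r p ^ (3 - Suc 0))\<bar> = 3 * (r p ^ 4 * \<bar>c\<bar>)" for c
      using r by (simp add: abs_mult power4_eq_xxxx power2_eq_square)
    ultimately show ?thesis by simp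
  qed
  show ?thesis
    unfolding eq by (rule abs_diff_le_of_deriv_bound[where f = "\<lambda>p. r p ^ 3", OF deriv bound])
qed

lemma velocity_lipschitz: "\<bar>velocity x - velocity y\<bar> \<le> \<bar>x - y\<bar>"
proof -
  have bound: "\<bar>velocity' p\<bar> \<le> 1" for p
    using velocity'_pos[of p] velocity'_le_1[of p] by simp
  have "\<bar>velocity x - velocity y\<bar> \<le> 1 * \<bar>x - y\<bar>"
    by (rule abs_diff_le_of_deriv_bound[where f = velocity, OF velocity_has_derivative bound])
  then show ?thesis by simp
qed

section \<open>The pendulum equation as an ODE in the plane\<close>

definition pendulum_field :: "real \<Rightarrow> (real \<Rightarrow> real) \<Rightarrow> real \<Rightarrow> real \<times> real \<Rightarrow> real \<times> real" where
  "pendulum_field a f t z = (velocity (snd z), - a * sin (fst z) + f t)"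

text \<open>The linearisation of \<open>pendulum_field a f\<close> along the curve \<open>z\<close>; the forcing drops out.\<close>

definition variational_field :: "real \<Rightarrow> (real \<Rightarrow> real \<times> real) \<Rightarrow> real \<Rightarrow> real \<times> real \<Rightarrow> real \<times> real" where
  "variational_field a z t v = (velocity' (snd (z t)) * snd v, - a * cos (fst (z t)) * fst v)"

lemma solves_ode_pair_iff:
  fixes F :: "real \<Rightarrow> real \<times> real \<Rightarrow> real \<times> real"
  shows "solves_ode F z \<longleftrightarrow>
    (\<forall>t. ((\<lambda>t. fst (z t)) has_real_derivative fst (F t (z t))) (at t) \<and>
         ((\<lambda>t. snd (z t)) has_real_derivative snd (F t (z t))) (at t))"
proof -
  have "(z has_vector_derivative d) (at t) \<longleftrightarrow>
      ((\<lambda>t. fst (z t)) has_real_derivative fst d) (at t) \<and>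
      ((\<lambda>t. snd (z t)) has_real_derivative snd d) (at t)" for d t
    unfolding has_real_derivative_iff_has_vector_derivative
    using has_vector_derivative_Pair[of "\<lambda>t. fst (z t)" "fst d" t UNIV "\<lambda>t. snd (z t)" "snd d"]
      bounded_linear.has_vector_derivative[OF bounded_linear_fst, of z d "at t"]
      bounded_linear.has_vector_derivative[OF bounded_linear_snd, of z d "at t"]
    by auto
  then show ?thesis by (simp add: solves_ode_def)
qed

lemma pendulum_solution_iff_solves_ode:
  "pendulum_solution a f (\<lambda>t. fst (z t)) (\<lambda>t. snd (z t)) \<longleftrightarrow> solves_ode (pendulum_field a f) z"
  by (simp add: pendulum_solution_def solves_ode_pair_iff pendulum_field_def velocity_def)

lemma norm_Pair_le_sum: "norm (x, y) \<le> norm x + norm y"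
  by (simp add: norm_Pair sqrt_add_le_add_sqrt[THEN order_trans])

lemma abs_fst_snd_le_norm:
  fixes v :: "real \<times> real"
  shows "\<bar>fst v\<bar> \<le> norm v" "\<bar>snd v\<bar> \<le> norm v"
  using norm_fst_le[of "fst v" "snd v"] norm_snd_le[of "snd v" "fst v"] by auto

lemma pair_norm_bound:
  fixes v :: "real \<times> real"
  assumes "\<bar>x\<bar> \<le> \<bar>snd v\<bar>" "\<bar>y\<bar> \<le> \<bar>a\<bar> * \<bar>fst v\<bar>"
  shows "norm (x, y) \<le> (1 + \<bar>a\<bar>) * norm v"
proof -
  have "norm (x, y) \<le> \<bar>x\<bar> + \<bar>y\<bar>" using norm_Pair_le_sum[of x y] by simp
  also have "\<dots> \<le> norm v + \<bar>a\<bar> * norm v"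
    using assms abs_fst_snd_le_norm[of v] mult_left_mono[of "\<bar>fst v\<bar>" "norm v" "\<bar>a\<bar>"] by linarith
  finally show ?thesis by (simp add: algebra_simps)
qed

lemma pendulum_field_lipschitz:
  "norm (pendulum_field a f t u - pendulum_field a f t v) \<le> (1 + \<bar>a\<bar>) * norm (u - v)"
proof -
  have "\<bar>sin x - sin y\<bar> \<le> \<bar>x - y\<bar>" for x y :: real
    using abs_diff_le_of_deriv_bound[of sin cos 1] by (auto intro: DERIV_sin)
  then have "\<bar>a * sin (fst v) - a * sin (fst u)\<bar> \<le> \<bar>a\<bar> * \<bar>fst (u - v)\<bar>"
    by (simp add: abs_mult mult_left_mono abs_minus_commute flip: right_diff_distrib)
  then show ?thesis
    unfolding pendulum_field_def using velocity_lipschitz[of "snd u" "snd v"]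
    by (simp add: pair_norm_bound)
qed

lemma variational_field_linear: "linear (variational_field a z t)"
  by (rule linearI) (auto simp: variational_field_def algebra_simps)

lemma variational_field_bound: "norm (variational_field a z t v) \<le> (1 + \<bar>a\<bar>) * norm v"
proof -
  have "velocity' (snd (z t)) * \<bar>snd v\<bar> \<le> 1 * \<bar>snd v\<bar>"
    using velocity'_le_1 by (intro mult_right_mono) auto
  moreover have "\<bar>a\<bar> * (\<bar>cos (fst (z t))\<bar> * \<bar>fst v\<bar>) \<le> \<bar>a\<bar> * (1 * \<bar>fst v\<bar>)"
    by (intro mult_left_mono mult_right_mono) auto
  ultimately show ?thesis
    unfolding variational_field_def using velocity'_pos[of "snd (z t)"]
    by (intro pair_norm_bound) (auto simp: abs_mult)
qed

lemma variational_field_lipschitz: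
  "norm (variational_field a z t u - variational_field a z t v) \<le> (1 + \<bar>a\<bar>) * norm (u - v)"
  using variational_field_bound[of a z t "u - v"] by (simp add: linear_diff[OF variational_field_linear])

lemma pendulum_field_remainder:
  "norm (pendulum_field a f t v - pendulum_field a f t (z t) - variational_field a z t (v - z t))
    \<le> (3 + \<bar>a\<bar>) * (norm (v - z t))\<^sup>2"
proof -
  define u where "u = v - z t"
  have "\<bar>velocity (snd v) - velocity (snd (z t)) - velocity' (snd (z t)) * snd u\<bar> \<le> 3 * (snd u)\<^sup>2"
    using quadratic_remainder[OF velocity_has_derivative velocity'_lipschitz] by (simp add: u_def)
  moreover have "(snd u)\<^sup>2 \<le> (norm u)\<^sup>2" "(fst u)\<^sup>2 \<le> (norm u)\<^sup>2"
    using power_mono[OF abs_fst_snd_le_norm(2)[of u], of 2] power_mono[OF abs_fst_snd_le_norm(1)[of u], of 2]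
    by auto
  moreover have "\<bar>cos x - cos y\<bar> \<le> 1 * \<bar>x - y\<bar>" for x y :: real
    by (rule abs_diff_le_of_deriv_bound[OF DERIV_cos]) simp
  then have "\<bar>sin (fst v) - sin (fst (z t)) - cos (fst (z t)) * fst u\<bar> \<le> 1 * (fst u)\<^sup>2"
    unfolding u_def fst_diff by (intro quadratic_remainder DERIV_sin) auto
  ultimately have 1: "\<bar>velocity (snd v) - velocity (snd (z t)) - velocity' (snd (z t)) * snd u\<bar> \<le> 3 * (norm u)\<^sup>2"
    and "\<bar>sin (fst v) - sin (fst (z t)) - cos (fst (z t)) * fst u\<bar> \<le> (norm u)\<^sup>2"
    by linarith+
  from this(2) have "\<bar>a\<bar> * \<bar>sin (fst v) - sin (fst (z t)) - cos (fst (z t)) * fst u\<bar> \<le> \<bar>a\<bar> * (norm u)\<^sup>2"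
    by (intro mult_left_mono) auto
  then have 2: "\<bar>- a * (sin (fst v) - sin (fst (z t)) - cos (fst (z t)) * fst u)\<bar> \<le> \<bar>a\<bar> * (norm u)\<^sup>2"
    by (simp only: abs_mult abs_minus_cancel)
  have "norm (pendulum_field a f t v - pendulum_field a f t (z t) - variational_field a z t u)
      = norm (velocity (snd v) - velocity (snd (z t)) - velocity' (snd (z t)) * snd u,
          - a * (sin (fst v) - sin (fst (z t)) - cos (fst (z t)) * fst u))"
    by (simp add: pendulum_field_def variational_field_def algebra_simps)
  also have "\<dots> \<le> (3 + \<bar>a\<bar>) * (norm u)\<^sup>2"
    using norm_Pair_le_sum[of "velocity (snd v) - velocity (snd (z t)) - velocity' (snd (z t)) * snd u"
      "- a * (sin (fst v) - sin (fst (z t)) - cos (fst (z t)) * fst u)"] 1 2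
    unfolding real_norm_def by (simp only: distrib_right)
  finally show ?thesis by (simp add: u_def)
qed

lemma trajectory_unique:
  assumes "solves_ode (pendulum_field a f) z" "z 0 = z0"
  shows "trajectory a f z0 = z"
  unfolding trajectory_def pendulum_solution_iff_solves_ode
proof (rule the_equality)
  show "y = z" if "solves_ode (pendulum_field a f) y \<and> y 0 = z0" for y
    using solves_ode_unique[OF _ assms(1) _ pendulum_field_lipschitz, of y 0] that assms(2) by auto
qed (use assms in auto)

lemma trajectory_solves:
  assumes "continuous_on UNIV f" "bounded (range f)"
  shows "solves_ode (pendulum_field a f) (trajectory a f z0)" "trajectory a f z0 0 = z0"
proof -
  obtain B where B: "\<And>t. \<bar>f t\<bar> \<le> B"
    using assms(2) by (auto simp: bounded_iff)
  have "continuous_on UNIV velocity"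
    using velocity_has_derivative by (meson DERIV_isCont continuous_at_imp_continuous_on)
  then have "continuous_on UNIV (\<lambda>x :: real \<times> real \<times> real. velocity (snd (snd x)))"
    by (rule continuous_on_compose2) (auto intro!: continuous_intros)
  moreover have "continuous_on UNIV (\<lambda>x :: real \<times> real \<times> real. f (fst x))"
    by (rule continuous_on_compose2[OF assms(1)]) (auto intro!: continuous_intros)
  ultimately have cont: "continuous_on UNIV (\<lambda>(t, v). pendulum_field a f t v)"
    unfolding pendulum_field_def split_def by (intro continuous_intros)
  have bdd: "norm (pendulum_field a f t z0) \<le> \<bar>velocity (snd z0)\<bar> + (\<bar>a\<bar> * \<bar>sin (fst z0)\<bar> + B)" for t
  proof -
    have "norm (pendulum_field a f t z0) \<le> \<bar>velocity (snd z0)\<bar> + \<bar>- a * sin (fst z0) + f t\<bar>"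
      unfolding pendulum_field_def using norm_Pair_le_sum[of "velocity (snd z0)" "- a * sin (fst z0) + f t"]
      by simp
    also have "\<bar>- a * sin (fst z0) + f t\<bar> \<le> \<bar>- a * sin (fst z0)\<bar> + \<bar>f t\<bar>"
      by (rule abs_triangle_ineq)
    finally show ?thesis using B[of t] by (simp add: abs_mult)
  qed
  obtain z where "solves_ode (pendulum_field a f) z" "z 0 = z0"
    using ode_global_existence[OF cont _ pendulum_field_lipschitz bdd] by auto
  then show "solves_ode (pendulum_field a f) (trajectory a f z0)" "trajectory a f z0 0 = z0"
    using trajectory_unique by auto
qed

section \<open>The derivative of the flow and the twist condition\<close>

lemma solves_ode_continuous:
  "solves_ode F z \<Longrightarrow> continuous_on S z"
  unfolding solves_ode_def
  by (meson continuous_at_imp_continuous_on has_vector_derivative_continuous)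

lemma variational_solution_exists:
  assumes "continuous_on UNIV z"
  obtains \<zeta> where "solves_ode (variational_field a z) \<zeta>" "\<zeta> 0 = v0"
proof -
  have "continuous_on UNIV velocity'"
    using velocity'_lipschitz
    by (intro lipschitz_on_continuous_on[of 3] lipschitz_onI) (auto simp: dist_real_def)
  then have "continuous_on UNIV (\<lambda>x :: real \<times> real \<times> real. velocity' (snd (z (fst x))))"
    by (rule continuous_on_compose2) (auto intro!: continuous_intros continuous_on_compose2[OF assms])
  moreover have "continuous_on UNIV (\<lambda>x :: real \<times> real \<times> real. z (fst x))"
    by (rule continuous_on_compose2[OF assms]) (auto intro!: continuous_intros)
  ultimately have cont: "continuous_on UNIV (\<lambda>(t, v). variational_field a z t v)"
    unfolding variational_field_def split_def by (intro continuous_intros)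
  show thesis
    by (rule ode_global_existence[OF cont _ variational_field_lipschitz variational_field_bound, of v0]) (use that in auto)
qed

theorem position_has_derivative_momentum:
  assumes f: "continuous_on UNIV f" "bounded (range f)" and "t \<ge> 0"
    and \<zeta>: "solves_ode (variational_field a (trajectory a f (q0, p0))) \<zeta>" "\<zeta> 0 = (0, 1)"
  shows "((\<lambda>p. fst (trajectory a f (q0, p) t)) has_real_derivative fst (\<zeta> t)) (at p0)"
proof -
  have "((\<lambda>p. trajectory a f (q0, p) t) has_vector_derivative \<zeta> t) (at p0)"
    by (rule flow_has_vector_derivative[where F = "pendulum_field a f" and L = "1 + \<bar>a\<bar>" and M = "3 + \<bar>a\<bar>"
        and A = "variational_field a (trajectory a f (q0, p0))"])
      (use trajectory_solves[OF f] \<zeta> \<open>t \<ge> 0\<close> in \<open>auto intro: variational_field_linear variational_field_bound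
        pendulum_field_lipschitz pendulum_field_remainder\<close>)
  then show ?thesis
    unfolding has_real_derivative_iff_has_vector_derivative
    by (rule bounded_linear.has_vector_derivative[OF bounded_linear_fst])
qed

lemma variational_solution_nonzero:
  assumes "solves_ode (variational_field a z) \<zeta>" "\<zeta> 0 \<noteq> 0"
  shows "\<zeta> t \<noteq> 0"
proof
  assume "\<zeta> t = 0"
  have "solves_ode (variational_field a z) (\<lambda>_. 0)"
    unfolding solves_ode_pair_iff by (simp add: variational_field_def)
  from solves_ode_unique[OF assms(1) this _ variational_field_lipschitz, of t] \<open>\<zeta> t = 0\<close> assms(2)
  show False by (auto simp: fun_eq_iff)
qed

text \<open>The derivative of \<open>Q\<close> with respect to \<open>p0\<close> is \<open>\<xi> T\<close>, where \<open>\<xi>' = w * \<eta>\<close>, \<open>\<eta>' = - c * \<xi>\<close>,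
  \<open>\<xi> 0 = 0\<close>, \<open>\<eta> 0 = 1\<close> and the coefficients are \<open>w = velocity' p\<close> and \<open>c = a * cos q\<close> along the
  orbit. They never exceed \<open>1\<close> and \<open>a\<close>, so \<open>sturm_positive\<close> applies.\<close>

lemma twist_if_variation_strict:
  assumes f: "continuous_on UNIV f" "bounded (range f)" and "T > 0" "0 < a" "a \<le> (pi / T)\<^sup>2"
    and strict: "\<And>z0. \<exists>t\<in>{0<..<T}. t \<noteq> T / 2 \<and>
      (velocity' (snd (trajectory a f z0 t)) < 1 \<or> a * cos (fst (trajectory a f z0 t)) < (pi / T)\<^sup>2)"
  shows "twist (poincare_map a f T)"
  unfolding twist_def poincare_map_def
proof (intro allI)
  fix q0 p0
  let ?z = "trajectory a f (q0, p0)"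
  obtain \<zeta> where \<zeta>: "solves_ode (variational_field a ?z) \<zeta>" "\<zeta> 0 = (0, 1)"
    using variational_solution_exists[OF solves_ode_continuous[OF trajectory_solves(1)[OF f]]] by blast
  have "fst (\<zeta> T) > 0"
  proof (rule sturm_positive[where w = "\<lambda>t. velocity' (snd (?z t))" and c = "\<lambda>t. a * cos (fst (?z t))"
        and \<eta> = "\<lambda>t. snd (\<zeta> t)" and T = T])
    show "((\<lambda>t. fst (\<zeta> t)) has_real_derivative velocity' (snd (?z t)) * snd (\<zeta> t)) (at t)"
      "((\<lambda>t. snd (\<zeta> t)) has_real_derivative - (a * cos (fst (?z t))) * fst (\<zeta> t)) (at t)" for t
      using \<zeta>(1) by (simp_all add: solves_ode_pair_iff variational_field_def)
    show "fst (\<zeta> t) \<noteq> 0 \<or> snd (\<zeta> t) \<noteq> 0" for t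
      using variational_solution_nonzero[OF \<zeta>(1), of t] \<zeta>(2) by (auto simp: prod_eq_iff)
    show "a * cos (fst (?z t)) \<le> (pi / T)\<^sup>2" for t
    proof -
      have "a * cos (fst (?z t)) \<le> a * 1" using \<open>0 < a\<close> by (intro mult_left_mono) auto
      then show ?thesis using \<open>a \<le> _\<close> by simp
    qed
  qed (use \<open>T > 0\<close> \<zeta>(2) strict velocity'_pos velocity'_le_1 in auto)
  then show "\<exists>D>0. ((\<lambda>p. fst (trajectory a f (q0, p) T)) has_real_derivative D) (at p0)"
    using position_has_derivative_momentum[OF f less_imp_le[OF \<open>T > 0\<close>] \<zeta>] by (intro exI conjI)
qed

lemma periodic_obtain_representative:
  fixes f :: "real \<Rightarrow> 'a" and T :: real
  assumes "T > 0" "\<And>t. f (t + T) = f t"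
  obtains s where "s \<in> {0..<T}" "f t = f s"
proof -
  interpret periodic_fun_simple f T by unfold_locales (rule assms(2))
  define n where "n = \<lfloor>t / T\<rfloor>"
  have "of_int n * T \<le> t" "t < (of_int n + 1) * T"
    unfolding n_def using floor_divide_lower[OF \<open>T > 0\<close>] floor_divide_upper[OF \<open>T > 0\<close>] by auto
  then show thesis
    using that[of "t - of_int n * T"] minus_of_int[of t n] by (auto simp: algebra_simps)
qed

lemma periodic_continuous_bounded:
  fixes f :: "real \<Rightarrow> real"
  assumes "T > 0" "\<And>t. f (t + T) = f t" "continuous_on UNIV f"
  shows "bounded (range f)"
proof (rule bounded_subset)
  show "bounded (f ` {0..T})"
    by (intro compact_imp_bounded compact_continuous_image continuous_on_subset[OF assms(3)]) auto
  show "range f \<subseteq> f ` {0..T}"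
  proof safe
    fix t
    obtain s where "s \<in> {0..<T}" "f t = f s"
      using periodic_obtain_representative[where f = f and t = t, OF assms(1,2)] by blast
    then show "f t \<in> f ` {0..T}" by auto
  qed
qed

lemma forcing_zero_if_resting_at_bottom:
  assumes z: "solves_ode (pendulum_field a f) z" and "open S" "t \<in> S"
    and rest: "\<And>s. s \<in> S \<Longrightarrow> snd (z s) = 0" "sin (fst (z t)) = 0"
  shows "f t = 0"
proof -
  have "((\<lambda>t. snd (z t)) has_real_derivative f t) (at t)"
  proof -
    have "((\<lambda>t. snd (z t)) has_real_derivative - a * sin (fst (z t)) + f t) (at t)"
      using z by (simp add: solves_ode_pair_iff pendulum_field_def)
    then show ?thesis using rest(2) by (simp only: mult_zero_right add_0)
  qed
  moreover have "((\<lambda>t. snd (z t)) has_real_derivative 0) (at t)"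
    by (rule has_field_derivative_transform_within_open[where S = S and f = "\<lambda>_. 0"])
      (use assms in auto)
  ultimately show ?thesis using DERIV_unique by blast
qed

text \<open>If the comparison is not strict along some orbit, then \<open>p = 0\<close> and \<open>cos q = 1\<close> on \<open>(0, T)\<close>
  except possibly at \<open>T / 2\<close>: the pendulum hangs at rest at the bottom, and that is only possible
  without forcing.\<close>

lemma twist_critical:
  assumes "T > 0" and adm: "admissible_forcing T f" and a: "a = (pi / T)\<^sup>2" and "\<exists>t. f t \<noteq> 0"
  shows "twist (poincare_map a f T)"
proof -
  have f: "continuous_on UNIV f" "\<And>t. f (t + T) = f t"
    using adm by (auto simp: admissible_forcing_def)
  have bdd: "bounded (range f)"
    using periodic_continuous_bounded[OF \<open>T > 0\<close> f(2,1)] .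
  have "a > 0" using \<open>T > 0\<close> by (simp add: a)
  obtain r where "r \<in> {0..<T}" "f r \<noteq> 0"
    using assms(4) periodic_obtain_representative[OF \<open>T > 0\<close>, of f] f(2) by metis
  show ?thesis
  proof (rule twist_if_variation_strict[OF f(1) bdd \<open>T > 0\<close> \<open>a > 0\<close>])
    fix z0
    let ?z = "trajectory a f z0" and ?S = "{0<..<T} - {T / 2}"
    have z: "solves_ode (pendulum_field a f) ?z"
      by (rule trajectory_solves[OF f(1) bdd])
    show "\<exists>t\<in>{0<..<T}. t \<noteq> T / 2 \<and>
      (velocity' (snd (?z t)) < 1 \<or> a * cos (fst (?z t)) < (pi / T)\<^sup>2)"
    proof (rule ccontr)
      assume "\<not> ?thesis"
      then have *: "velocity' (snd (?z t)) \<ge> 1" "a * cos (fst (?z t)) \<ge> a * 1" if "t \<in> ?S" for t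
        using that by (auto simp: not_less a)
      have p0: "snd (?z t) = 0" if "t \<in> ?S" for t
        using *(1)[OF that] velocity'_le_1[of "snd (?z t)"] velocity'_eq_1 by force
      have sin0: "sin (fst (?z t)) = 0" if "t \<in> ?S" for t
      proof -
        have "cos (fst (?z t)) = 1"
          using *(2)[OF that] \<open>a > 0\<close> cos_le_one[of "fst (?z t)"] by simp
        then show ?thesis by (simp add: cos_one_sin_zero)
      qed
      have "f t = 0" if "t \<in> ?S" for t
        using that p0 sin0 by (intro forcing_zero_if_resting_at_bottom[OF z, of ?S]) auto
      moreover have "closure ?S = {0..T}"
      proof -
        have "closure ({0<..<T} - {T / 2}) = closure ({0<..<T / 2} \<union> {T / 2<..<T})"
          using \<open>T > 0\<close> by (intro arg_cong[where f = closure]) auto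
        also have "\<dots> = {0..T}"
          using \<open>T > 0\<close> by (simp add: closure_Un) auto
        finally show ?thesis .
      qed
      ultimately have "f r = 0"
        using continuous_constant_on_closure[of ?S f 0 r] continuous_on_subset[OF f(1)] \<open>r \<in> _\<close> by auto
      then show False using \<open>f r \<noteq> 0\<close> by simp
    qed
  qed (simp add: a)
qed

lemma twist_subcritical:
  assumes "T > 0" and adm: "admissible_forcing T f" and a: "0 < a" "a < (pi / T)\<^sup>2"
  shows "twist (poincare_map a f T)"
proof -
  have f: "continuous_on UNIV f" "\<And>t. f (t + T) = f t"
    using adm by (auto simp: admissible_forcing_def)
  show ?thesis
  proof (rule twist_if_variation_strict[OF f(1) _ \<open>T > 0\<close> a(1)])
    show "\<exists>t\<in>{0<..<T}. t \<noteq> T / 2 \<and> (velocity' (snd (trajectory a f z0 t)) < 1 \<or>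
        a * cos (fst (trajectory a f z0 t)) < (pi / T)\<^sup>2)" for z0
    proof -
      have "a * cos (fst (trajectory a f z0 (T / 3))) \<le> a * 1"
        using a by (intro mult_left_mono) auto
      then have "a * cos (fst (trajectory a f z0 (T / 3))) < (pi / T)\<^sup>2"
        using a by linarith
      then show ?thesis using \<open>T > 0\<close> by (intro bexI[of _ "T / 3"]) auto
    qed
  qed (use periodic_continuous_bounded[OF \<open>T > 0\<close> f(2,1)] a in auto)
qed

lemma trajectory_at_rest: "trajectory a (\<lambda>_. 0) (0, 0) = (\<lambda>_. (0, 0))"
  by (rule trajectory_unique) (auto simp: solves_ode_pair_iff pendulum_field_def velocity_def)

section \<open>Loss of twist beyond the critical value\<close>

lemma position_derivative_at_rest:
  assumes "a > 0" "t \<ge> 0"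
  shows "((\<lambda>p. fst (trajectory a (\<lambda>_. 0) (0, p) t)) has_real_derivative sin (sqrt a * t) / sqrt a) (at 0)"
proof -
  have "((\<lambda>p. fst (trajectory a (\<lambda>_. 0) (0, p) t)) has_real_derivative
      fst ((\<lambda>t. (sin (sqrt a * t) / sqrt a, cos (sqrt a * t))) t)) (at 0)"
  proof (rule position_has_derivative_momentum)
    have "sqrt a * sqrt a = a" "sqrt a > 0" using \<open>a > 0\<close> by auto
    then have "a * sin (sqrt a * t) / sqrt a = sqrt a * sin (sqrt a * t)"
      "cos (sqrt a * t) * sqrt a * sqrt a / a = cos (sqrt a * t)" for t
      using \<open>a > 0\<close> by (simp_all add: field_simps)
    then show "solves_ode (variational_field a (trajectory a (\<lambda>_. 0) (0, 0)))
        (\<lambda>t. (sin (sqrt a * t) / sqrt a, cos (sqrt a * t)))"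
      unfolding trajectory_at_rest solves_ode_pair_iff using \<open>sqrt a > 0\<close>
      by (auto intro!: derivative_eq_intros simp: variational_field_def velocity'_def)
  qed (use assms in auto)
  then show ?thesis by simp
qed

lemma min_over_compact_lipschitz:
  fixes g :: "real \<Rightarrow> 'b::topological_space \<Rightarrow> real"
  assumes S: "compact S" "S \<noteq> {}"
    and cont: "\<And>p. continuous_on S (g p)"
    and lip: "\<And>p p' t. t \<in> S \<Longrightarrow> \<bar>g p t - g p' t\<bar> \<le> C * \<bar>p - p'\<bar>"
  shows "\<exists>m. continuous_on UNIV m \<and> (\<forall>p. \<forall>t\<in>S. m p \<le> g p t) \<and> (\<forall>p. \<exists>t\<in>S. m p = g p t)"
proof -
  have "\<exists>t. t \<in> S \<and> (\<forall>s\<in>S. g p t \<le> g p s)" for p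
    using continuous_attains_inf[OF S cont, of p] by blast
  then obtain t where t: "\<And>p. t p \<in> S" "\<And>p s. s \<in> S \<Longrightarrow> g p (t p) \<le> g p s" by metis
  define m where "m p = g p (t p)" for p
  have *: "m p \<le> m p' + C * \<bar>p - p'\<bar>" for p p'
    using t(2)[OF t(1), of p p'] lip[OF t(1), of p p' p'] by (auto simp: m_def)
  have "\<bar>m p - m p'\<bar> \<le> max C 0 * \<bar>p - p'\<bar>" for p p'
    using *[of p p'] *[of p' p] mult_right_mono[of C "max C 0" "\<bar>p - p'\<bar>"]
    by (simp add: abs_minus_commute abs_le_iff)
  then have "continuous_on UNIV m"
    by (intro lipschitz_on_continuous_on[of "max C 0"] lipschitz_onI) (auto simp: dist_real_def)
  moreover have "\<forall>p. \<forall>t\<in>S. m p \<le> g p t" "\<forall>p. \<exists>t\<in>S. m p = g p t"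
    using t by (auto simp: m_def)
  ultimately show ?thesis by blast
qed

text \<open>A shooting argument for the free pendulum started at the bottom with momentum \<open>p\<close>. For small
  \<open>p\<close> the motion is close to the harmonic oscillator of half-period \<open>pi / sqrt a < T\<close>, so the
  position becomes negative before \<open>T\<close>; for large \<open>p\<close> the pendulum rotates and the position stays
  positive on \<open>(0, T]\<close>. The minimum of the position over \<open>{\<delta>..T}\<close>, with \<open>\<delta>\<close> so small that the
  position is positive on \<open>(0, \<delta>]\<close> for all momenta considered, depends continuously on \<open>p\<close> and hence is zero for
  some \<open>p\<close>. If it were attained before \<open>T\<close>, position and velocity would vanish together there, which
  only happens for the pendulum at rest. So it is attained at \<open>T\<close>.\<close>

lemma half_period_orbit_exists:
  assumes "T > 0" "a > (pi / T)\<^sup>2"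
  obtains p where "p > 0" "fst (trajectory a (\<lambda>_. 0) (0, p) T) = 0"
proof -
  let ?F = "pendulum_field a (\<lambda>_. 0)"
  define z where "z p = trajectory a (\<lambda>_. 0) (0, p)" for p
  have z: "solves_ode ?F (z p)" "z p 0 = (0, p)" for p
    unfolding z_def by (rule trajectory_solves; simp)+
  have q': "((\<lambda>t. fst (z p t)) has_real_derivative velocity (snd (z p t))) (at t)"
    and p': "((\<lambda>t. snd (z p t)) has_real_derivative - a * sin (fst (z p t))) (at t)" for p t
    using z(1)[of p] by (auto simp: solves_ode_pair_iff pendulum_field_def)
  have "a > 0" using assms by (meson le_less_trans zero_le_power2)
  \<comment> \<open>The momentum decreases at rate at most \<open>a\<close>, so the pendulum moves forward up to time \<open>p / a\<close>.\<close>
  have early: "fst (z p t) > 0" if "0 < t" "a * t < p" for p t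
  proof -
    have "velocity (snd (z p s)) > 0" if s: "0 \<le> s" "s \<le> t" for s
    proof -
      have "(\<lambda>s. snd (z p s) + a * s) 0 \<le> (\<lambda>s. snd (z p s) + a * s) s"
      proof (rule DERIV_nonneg_imp_nondecreasing[OF s(1)])
        fix r
        have "((\<lambda>s. snd (z p s) + a * s) has_real_derivative a * (1 - sin (fst (z p r)))) (at r)"
          by (rule derivative_eq_intros p' refl)+ (simp add: algebra_simps)
        then show "\<exists>y. ((\<lambda>s. snd (z p s) + a * s) has_real_derivative y) (at r) \<and> 0 \<le> y"
          using \<open>a > 0\<close> by fastforce
      qed
      moreover have "a * s \<le> a * t" using s \<open>a > 0\<close> by simp
      ultimately have "snd (z p s) > 0" using z(2)[of p] \<open>a * t < p\<close> by simp
      then show ?thesis by (simp add: velocity_def sq_plus_1_pos)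
    qed
    then have "fst (z p 0) < fst (z p t)"
      using q' by (intro DERIV_pos_imp_increasing[OF \<open>0 < t\<close>]) blast
    then show ?thesis using z(2)[of p] by simp
  qed
  have sqrt_a: "sqrt a * T > pi"
  proof -
    have "pi / T < sqrt a" using assms(2) by (rule real_less_rsqrt)
    then show ?thesis using \<open>T > 0\<close> by (simp add: field_simps)
  qed
  \<comment> \<open>A time up to \<open>T\<close> at which the harmonic oscillator is on its second half-swing; \<open>3 * pi / 2\<close> is
    an arbitrary choice between \<open>pi\<close> and \<open>2 * pi\<close>.\<close>
  define t1 where "t1 = min T (3 * pi / 2 / sqrt a)"
  have "sqrt a > 0" using \<open>a > 0\<close> by simp
  have t1: "0 < t1" "t1 \<le> T" "pi < sqrt a * t1" "sqrt a * t1 < 2 * pi"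
    using \<open>T > 0\<close> \<open>sqrt a > 0\<close> sqrt_a
    by (auto simp: t1_def min_def field_simps)
  have "sin (sqrt a * t1) / sqrt a < 0"
    using sin_lt_zero[OF t1(3,4)] \<open>sqrt a > 0\<close> by (simp add: divide_neg_pos)
  then obtain d where "d > 0" and d: "\<And>h. 0 < h \<Longrightarrow> h < d \<Longrightarrow> fst (z (0 + h) t1) < fst (z 0 t1)"
    using DERIV_neg_dec_right[OF position_derivative_at_rest[OF \<open>a > 0\<close>, of t1]] t1(1)
    unfolding z_def by auto
  have z0: "z 0 = (\<lambda>_. 0)"
    unfolding z_def zero_prod_def by (rule trajectory_at_rest)
  define p1 where "p1 = d / 2"
  have p1: "p1 > 0" "fst (z p1 t1) < 0"
    using d[of p1] \<open>d > 0\<close> z0 by (auto simp: p1_def)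
  define \<delta> where "\<delta> = p1 / (2 * a)"
  have "\<delta> > 0" using p1 \<open>a > 0\<close> by (simp add: \<delta>_def)
  have a\<delta>: "a * \<delta> < p1" using p1 \<open>a > 0\<close> by (simp add: \<delta>_def)
  have "\<delta> \<le> t1"
  proof (rule ccontr)
    assume "\<not> \<delta> \<le> t1"
    then have "a * t1 < a * \<delta>" using \<open>a > 0\<close> by simp
    then show False using early[OF t1(1), of p1] a\<delta> p1 by simp
  qed
  define p2 where "p2 = max p1 (a * T) + 1"
  have lip: "\<bar>fst (z p t) - fst (z p' t)\<bar> \<le> exp (((1 + \<bar>a\<bar>) + 1/2) * T) * \<bar>p - p'\<bar>" if "t \<in> {\<delta>..T}" for p p' t
  proof -
    have "norm (z p t - z p' t) \<le> exp (((1 + \<bar>a\<bar>) + 1/2) * (t - 0)) * norm (z p 0 - z p' 0)"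
      using that \<open>\<delta> > 0\<close> by (intro solves_ode_dist[OF z(1) z(1)] pendulum_field_lipschitz) auto
    also have "\<dots> \<le> exp (((1 + \<bar>a\<bar>) + 1/2) * T) * norm (z p 0 - z p' 0)"
      using that by (intro mult_right_mono) (simp_all add: mult_left_mono)
    finally show ?thesis
      using abs_fst_snd_le_norm(1)[of "z p t - z p' t"] z(2)[of p] z(2)[of p'] by (simp add: norm_Pair)
  qed
  have cont: "continuous_on {\<delta>..T} (\<lambda>t. fst (z p t))" for p
    by (intro continuous_intros solves_ode_continuous[OF z(1)])
  have nonempty: "{\<delta>..T} \<noteq> {}" using \<open>\<delta> \<le> t1\<close> t1 by simp
  obtain m where m: "continuous_on UNIV m" "\<And>p t. t \<in> {\<delta>..T} \<Longrightarrow> m p \<le> fst (z p t)"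
    "\<And>p. \<exists>t\<in>{\<delta>..T}. m p = fst (z p t)"
    using min_over_compact_lipschitz[where g = "\<lambda>p t. fst (z p t)", OF compact_Icc nonempty cont lip]
    by blast
  have "m p1 \<le> 0" using m(2)[of t1 p1] \<open>\<delta> \<le> t1\<close> t1 p1 by auto
  moreover have "m p2 \<ge> 0"
  proof -
    obtain t where t: "t \<in> {\<delta>..T}" "m p2 = fst (z p2 t)" using m(3) by blast
    then have "a * t \<le> a * T" using \<open>a > 0\<close> by simp
    then have "a * t < p2" by (simp add: p2_def)
    then show ?thesis using early[of t p2] t \<open>\<delta> > 0\<close> by simp
  qed
  moreover have "p1 \<le> p2" by (simp add: p2_def)
  ultimately obtain p where p: "p1 \<le> p" "p \<le> p2" "m p = 0"
    using IVT'[of m p1 0 p2] continuous_on_subset[OF m(1)] by auto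
  obtain t where t: "t \<in> {\<delta>..T}" "fst (z p t) = 0" using m(3)[of p] p(3) by auto
  have "t \<noteq> \<delta>" using early[of \<delta> p] \<open>\<delta> > 0\<close> a\<delta> p t by auto
  have "t = T"
  proof (rule ccontr)
    assume "t \<noteq> T"
    define e where "e = min (t - \<delta>) (T - t)"
    have "e > 0" using t \<open>t \<noteq> \<delta>\<close> \<open>t \<noteq> T\<close> by (auto simp: e_def)
    have "\<forall>s. \<bar>t - s\<bar> < e \<longrightarrow> fst (z p t) \<le> fst (z p s)"
    proof (intro allI impI)
      fix s assume "\<bar>t - s\<bar> < e"
      then have "s \<in> {\<delta>..T}" by (auto simp: e_def)
      then show "fst (z p t) \<le> fst (z p s)" using m(2)[of s p] p(3) t(2) by simp
    qed
    then have "velocity (snd (z p t)) = 0"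
      by (rule DERIV_local_min[OF q' \<open>e > 0\<close>])
    then have "z p t = 0"
      using t(2) sq_plus_1_pos[of "snd (z p t)"] by (simp add: velocity_def prod_eq_iff)
    then have "z p = z 0"
      using z0 by (intro solves_ode_unique[OF z(1) z(1) _ pendulum_field_lipschitz]) auto
    then show False using z(2)[of p] z(2)[of 0] p(1) p1 by simp
  qed
  then show thesis using that[of p] p(1) p1 t(2) by (simp add: z_def)
qed

text \<open>Two orbits of the free pendulum that start at position \<open>0\<close> with different momenta, the resting
  one and the one just found, return to position \<open>0\<close> at time \<open>T\<close>. Under the twist condition the
  final position would be strictly increasing in the initial momentum.\<close>

lemma not_twist_supercritical:
  assumes "T > 0" "a > (pi / T)\<^sup>2"
  shows "\<not> twist (poincare_map a (\<lambda>_. 0) T)"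
proof
  assume twist: "twist (poincare_map a (\<lambda>_. 0) T)"
  obtain p where p: "p > 0" "fst (trajectory a (\<lambda>_. 0) (0, p) T) = 0"
    using half_period_orbit_exists[OF assms] .
  have "fst (trajectory a (\<lambda>_. 0) (0, 0) T) < fst (trajectory a (\<lambda>_. 0) (0, p) T)"
    using twist unfolding twist_def poincare_map_def
    by (intro DERIV_pos_imp_increasing[OF \<open>p > 0\<close>]) blast
  then show False using p(2) by (simp add: trajectory_at_rest)
qed

theorem theorem2:
  fixes T :: real
  assumes "T > 0"
  shows "(\<forall>a > 0. \<forall>f. admissible_forcing T f \<longrightarrow>
            (a < pi\<^sup>2 / T\<^sup>2 \<longrightarrow> twist (poincare_map a f T)) \<and>
            (a = pi\<^sup>2 / T\<^sup>2 \<and> (\<exists>t. f t \<noteq> 0) \<longrightarrow> twist (poincare_map a f T))) \<and>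
         (\<forall>a > pi\<^sup>2 / T\<^sup>2. \<exists>f. admissible_forcing T f \<and> \<not> twist (poincare_map a f T))"
proof -
  have "admissible_forcing T (\<lambda>_. 0)" by (simp add: admissible_forcing_def)
  then show ?thesis
    using twist_subcritical[OF assms] twist_critical[OF assms] not_twist_supercritical[OF assms]
    by (auto simp: power_divide)
qed

end
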